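(* Let $\|\cdot\|$ be a norm on $\mathbb{R}^n$, $\mathcal{X}\subset\mathbb{R}^n$ compact and convex, and $\Phi:\mathcal{D}\to\mathbb{R}$ a mirror map that is $\rho$-strongly convex on $\mathcal{X}\cap\mathcal{D}$ with respect to $\|\cdot\|$, $\rho>0$. Let $x_1\in\mathrm{argmin}_{x\in\mathcal{X}\cap\mathcal{D}}\Phi(x)$ and $R^2=\sup_{x\in\mathcal{X}\cap\mathcal{D}}\Phi(x)-\Phi(x_1)$. Let $f$ be convex and $\beta$-smooth with respect to $\|\cdot\|$ on $\mathcal{X}$, $\beta>0$, with minimizer $x^*$ on $\mathcal{X}$. Let mirror prox with $\eta=\frac\rho\beta$ be defined, for $s\ge 1$, by $$\nabla\Phi(y_{s+1}')=\nabla\Phi(x_s)-\eta\nabla f(x_s),\qquad y_{s+1}\in\mathrm{argmin}_{x\in\mathcal{X}\cap\mathcal{D}}D_\Phi(x,y_{s+1}'),$$ $$\nabla\Phi(x_{s+1}')=\nabla\Phi(x_s)-\eta\nabla f(y_{s+1}),\qquad x_{s+1}\in\mathrm{argmin}_{x\in\mathcal{X}\cap\mathcal{D}}D_\Phi(x,x_{s+1}'),$$ with $y_{s+1}',x_{s+1}'\in\mathcal{D}$. Then for every $t\ge 1$, $$f\left(\frac1t\sum_{s=1}^ty_{s+1}\right)-f(x^* )\le\frac{\beta R^2}{\rho t}.$$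
   Context: The dual norm is $\|g\|_*=\sup_{\|x\|\le1}g^\top x$. $f$ is $\beta$-smooth w.r.t. $\|\cdot\|$ if it is differentiable with $\|\nabla f(x)-\nabla f(y)\|_*\le\beta\|x-y\|$ for all $x,y\in\mathcal{X}$. Mirror map: $\mathcal{D}\subset\mathbb{R}^n$ is a convex open set with $\mathcal{X}\subset\overline{\mathcal{D}}$ and $\mathcal{X}\cap\mathcal{D}\ne\emptyset$; $\Phi:\mathcal{D}\to\mathbb{R}$ is a mirror map if (i) it is strictly convex and differentiable, (ii) $\nabla\Phi(\mathcal{D})=\mathbb{R}^n$, (iii) $\|\nabla\Phi(x)\|\to+\infty$ as $x\to\partial\mathcal{D}$. $\Phi$ is $\rho$-strongly convex on $\mathcal{X}\cap\mathcal{D}$ w.r.t. $\|\cdot\|$ if $\Phi(x)-\Phi(y)\le\nabla\Phi(x)^\top(x-y)-\frac\rho2\|x-y\|^2$ for all $x,y\in\mathcal{X}\cap\mathcal{D}$. Bregman divergence: $D_\Phi(x,y)=\Phi(x)-\Phi(y)-\nabla\Phi(y)^\top(x-y)$. *)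

theory Defs
  imports "HOL-Analysis.Analysis"
begin

text \<open>An arbitrary norm on \<open>\<real>\<^sup>n\<close>, as opposed to the Euclidean norm of the type class.\<close>

definition is_norm :: "(real ^ 'n \<Rightarrow> real) \<Rightarrow> bool" where
  "is_norm N \<longleftrightarrow>
     (\<forall>x. 0 \<le> N x) \<and> (\<forall>x. N x = 0 \<longleftrightarrow> x = 0) \<and>
     (\<forall>c x. N (c *\<^sub>R x) = \<bar>c\<bar> * N x) \<and> (\<forall>x y. N (x + y) \<le> N x + N y)"

definition dual_norm :: "(real ^ 'n \<Rightarrow> real) \<Rightarrow> real ^ 'n \<Rightarrow> real" where
  "dual_norm N g = (SUP x\<in>{x. N x \<le> 1}. g \<bullet> x)"

text \<open>
  \<open>f\<close> is a function on \<open>X\<close>, so differentiability is taken relative to \<open>X\<close>. At points where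
  this does not determine the gradient (e.g. if \<open>X\<close> has empty interior), \<open>gf\<close> is some
  fixed choice of it; a function differentiable on a neighbourhood of \<open>X\<close>, with its
  ordinary gradient, is a special case.
\<close>

definition smooth_on ::
    "(real ^ 'n \<Rightarrow> real) \<Rightarrow> (real ^ 'n) set \<Rightarrow> real \<Rightarrow> (real ^ 'n \<Rightarrow> real) \<Rightarrow> (real ^ 'n \<Rightarrow> real ^ 'n) \<Rightarrow> bool" where
  "smooth_on N X \<beta> f gf \<longleftrightarrow>
     (\<forall>x\<in>X. (f has_derivative (\<lambda>h. gf x \<bullet> h)) (at x within X)) \<and>
     (\<forall>x\<in>X. \<forall>y\<in>X. dual_norm N (gf x - gf y) \<le> \<beta> * N (x - y))"

definition strictly_convex_on :: "(real ^ 'n) set \<Rightarrow> (real ^ 'n \<Rightarrow> real) \<Rightarrow> bool" where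
  "strictly_convex_on D \<Phi> \<longleftrightarrow> convex D \<and>
     (\<forall>x\<in>D. \<forall>y\<in>D. \<forall>u. x \<noteq> y \<and> 0 < u \<and> u < 1 \<longrightarrow>
        \<Phi> ((1 - u) *\<^sub>R x + u *\<^sub>R y) < (1 - u) * \<Phi> x + u * \<Phi> y)"

text \<open>
  \<open>g\<Phi>\<close> is the gradient of \<open>\<Phi>\<close>; as \<open>D\<close> is open, it is uniquely determined on \<open>D\<close>.
  The blow-up condition is read pointwise: the limit is \<open>\<infinity>\<close> at every boundary point of \<open>D\<close>.
\<close>

definition mirror_map ::
    "(real ^ 'n \<Rightarrow> real) \<Rightarrow> (real ^ 'n) set \<Rightarrow> (real ^ 'n) set \<Rightarrow> (real ^ 'n \<Rightarrow> real) \<Rightarrow>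
     (real ^ 'n \<Rightarrow> real ^ 'n) \<Rightarrow> bool" where
  "mirror_map N X D \<Phi> g\<Phi> \<longleftrightarrow>
     open D \<and> convex D \<and> X \<subseteq> closure D \<and> X \<inter> D \<noteq> {} \<and>
     strictly_convex_on D \<Phi> \<and> (\<forall>x\<in>D. GDERIV \<Phi> x :> g\<Phi> x) \<and>
     g\<Phi> ` D = UNIV \<and>
     (\<forall>z\<in>frontier D. filterlim (\<lambda>x. N (g\<Phi> x)) at_top (at z within D))"

definition strongly_convex_on ::
    "(real ^ 'n \<Rightarrow> real) \<Rightarrow> (real ^ 'n) set \<Rightarrow> real \<Rightarrow> (real ^ 'n \<Rightarrow> real) \<Rightarrow> (real ^ 'n \<Rightarrow> real ^ 'n) \<Rightarrow> bool" where
  "strongly_convex_on N S \<rho> \<Phi> g\<Phi> \<longleftrightarrow>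
     (\<forall>x\<in>S. \<forall>y\<in>S. \<Phi> x - \<Phi> y \<le> g\<Phi> x \<bullet> (x - y) - \<rho> / 2 * (N (x - y))\<^sup>2)"

definition bregman ::
    "(real ^ 'n \<Rightarrow> real) \<Rightarrow> (real ^ 'n \<Rightarrow> real ^ 'n) \<Rightarrow> real ^ 'n \<Rightarrow> real ^ 'n \<Rightarrow> real" where
  "bregman \<Phi> g\<Phi> x y = \<Phi> x - \<Phi> y - g\<Phi> y \<bullet> (x - y)"

end

theory Submission
  imports Defs
begin

text \<open>
  Mirror prox is a mirror descent whose steps from \<open>x\<^sub>s\<close> use the gradient at the
  look-ahead point \<open>y\<^sub>s\<^sub>+\<^sub>1\<close> in place of the gradient at \<open>x\<^sub>s\<close>. Fix a comparison point
  \<open>u \<in> X \<inter> D\<close>. By convexity \<open>f y\<^sub>s\<^sub>+\<^sub>1 - f u \<le> \<nabla>f y\<^sub>s\<^sub>+\<^sub>1 \<bullet> (y\<^sub>s\<^sub>+\<^sub>1 - u)\<close>, and the right-hand side is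
  the sum of
    \<^item> \<open>\<nabla>f y\<^sub>s\<^sub>+\<^sub>1 \<bullet> (x\<^sub>s\<^sub>+\<^sub>1 - u)\<close>, governed by the step from \<open>x\<^sub>s\<close> to \<open>x\<^sub>s\<^sub>+\<^sub>1\<close>,
    \<^item> \<open>\<nabla>f x\<^sub>s \<bullet> (y\<^sub>s\<^sub>+\<^sub>1 - x\<^sub>s\<^sub>+\<^sub>1)\<close>, governed by the step from \<open>x\<^sub>s\<close> to \<open>y\<^sub>s\<^sub>+\<^sub>1\<close>,
    \<^item> \<open>(\<nabla>f y\<^sub>s\<^sub>+\<^sub>1 - \<nabla>f x\<^sub>s) \<bullet> (y\<^sub>s\<^sub>+\<^sub>1 - x\<^sub>s\<^sub>+\<^sub>1)\<close>, governed by smoothness.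

  Both steps are mirror steps, and the optimality of the Bregman projection bounds the first two
  terms (times \<open>\<eta>\<close>) by differences of divergences (\<open>mirror_step_inequality\<close>). Their sum is
  \<open>D\<^sub>\<Phi>(u, x\<^sub>s) - D\<^sub>\<Phi>(u, x\<^sub>s\<^sub>+\<^sub>1)\<close> minus \<open>D\<^sub>\<Phi>(x\<^sub>s\<^sub>+\<^sub>1, y\<^sub>s\<^sub>+\<^sub>1) + D\<^sub>\<Phi>(y\<^sub>s\<^sub>+\<^sub>1, x\<^sub>s)\<close>. By strong convexity the
  subtracted part is at least \<open>\<rho>/2\<close> times the sum of the two squared distances; by smoothness and
  the inequality \<open>2ab \<le> a\<^sup>2 + b\<^sup>2\<close> the third term is at most \<open>\<beta>/2\<close> times the same sum. For
  \<open>\<eta> = \<rho>/\<beta>\<close> these cancel (\<open>mirror_prox_step\<close>), so summing over \<open>s\<close> telescopes and leaves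
  \<open>D\<^sub>\<Phi>(u, x\<^sub>1) \<le> \<Phi> u - \<Phi> x\<^sub>1 \<le> R\<^sup>2\<close>. Jensen's inequality passes to the averaged iterate.

  The minimizer \<open>x\<^sup>*\<close> may lie on the boundary of \<open>D\<close>, where the comparison above does not apply. It is
  approached from inside \<open>X \<inter> D\<close> along the segment from \<open>x\<^sub>1\<close>
  (\<open>convex_bound_extends_to_closure\<close>).
\<close>

section \<open>First-order conditions on convex sets\<close>

lemma difference_quotient_tendsto_within:
  fixes f :: "'a::real_normed_vector \<Rightarrow> real"
  assumes der: "(f has_derivative f') (at a within S)"
    and S: "convex S" "a \<in> S" "b \<in> S"
  shows "((\<lambda>h. (f (a + h *\<^sub>R (b - a)) - f a) / h) \<longlongrightarrow> f' (b - a)) (at_right 0)"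
proof -
  let ?p = "\<lambda>h::real. a + h *\<^sub>R (b - a)"
  have lin: "linear f'" using der by (rule has_derivative_linear)
  have seg: "?p ` {0..1} \<subseteq> S"
  proof (rule image_subsetI)
    fix h :: real assume "h \<in> {0..1}"
    then have "(1 - h) *\<^sub>R a + h *\<^sub>R b \<in> S"
      using S by (intro convexD) auto
    then show "?p h \<in> S" by (simp add: algebra_simps)
  qed
  have p: "(?p has_derivative (\<lambda>h. h *\<^sub>R (b - a))) (at 0 within {0..1})"
    by (auto intro!: derivative_eq_intros)
  have "(f has_derivative f') (at (?p 0) within ?p ` {0..1})"
    using has_derivative_subset[OF der seg] by simp
  from has_derivative_in_compose[OF p this]
  have "((\<lambda>h. f (?p h)) has_derivative (\<lambda>h. f' (h *\<^sub>R (b - a)))) (at 0 within {0..1})" .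
  moreover have "(\<lambda>h. f' (h *\<^sub>R (b - a))) = (*) (f' (b - a))"
    using linear_cmul[OF lin] by (auto simp: mult.commute)
  ultimately have "((\<lambda>h. f (?p h)) has_field_derivative f' (b - a)) (at 0 within {0..1})"
    by (simp add: has_field_derivative_def)
  then show ?thesis
    by (simp add: has_field_derivative_iff at_within_Icc_at_right)
qed

text \<open>Convexity bounds every difference quotient along the segment by its value at the far end.\<close>

lemma convex_on_gradient_inequality:
  fixes f :: "'a::real_normed_vector \<Rightarrow> real"
  assumes f: "convex_on S f" and der: "(f has_derivative f') (at a within S)"
    and ab: "a \<in> S" "b \<in> S"
  shows "f a + f' (b - a) \<le> f b"
proof -
  have S: "convex S" using f by (rule convex_on_imp_convex)
  have "(f (a + h *\<^sub>R (b - a)) - f a) / h \<le> f b - f a" if "0 < h" "h < 1" for h :: real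
  proof -
    have "f ((1 - h) *\<^sub>R a + h *\<^sub>R b) \<le> (1 - h) * f a + h * f b"
      using convex_onD[OF f, of h a b] that ab by simp
    moreover have "(1 - h) *\<^sub>R a + h *\<^sub>R b = a + h *\<^sub>R (b - a)"
      by (simp add: algebra_simps)
    ultimately show ?thesis using that by (simp add: field_simps)
  qed
  then have "\<forall>\<^sub>F h in at_right (0::real). (f (a + h *\<^sub>R (b - a)) - f a) / h \<le> f b - f a"
    unfolding eventually_at_right_field by (intro exI[of _ 1]) auto
  then have "f' (b - a) \<le> f b - f a"
    using difference_quotient_tendsto_within[OF der S ab] trivial_limit_at_right_real
    by (intro tendsto_upperbound)
  then show ?thesis by simp
qed

lemma arg_min_first_order:
  fixes f :: "'a::real_normed_vector \<Rightarrow> real"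
  assumes min: "is_arg_min f (\<lambda>z. z \<in> S) a" and der: "(f has_derivative f') (at a within S)"
    and S: "convex S" and b: "b \<in> S"
  shows "0 \<le> f' (b - a)"
proof -
  have a: "a \<in> S" and le: "\<And>z. z \<in> S \<Longrightarrow> f a \<le> f z"
    using min by (auto simp: is_arg_min_linorder)
  have "0 \<le> (f (a + h *\<^sub>R (b - a)) - f a) / h" if "0 < h" "h < 1" for h :: real
  proof -
    have "(1 - h) *\<^sub>R a + h *\<^sub>R b \<in> S"
      using that a b S by (intro convexD) auto
    moreover have "(1 - h) *\<^sub>R a + h *\<^sub>R b = a + h *\<^sub>R (b - a)"
      by (simp add: algebra_simps)
    ultimately show ?thesis using le that by simp
  qed
  then have "\<forall>\<^sub>F h in at_right (0::real). 0 \<le> (f (a + h *\<^sub>R (b - a)) - f a) / h"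
    unfolding eventually_at_right_field by (intro exI[of _ 1]) auto
  then show ?thesis
    using difference_quotient_tendsto_within[OF der S a b] trivial_limit_at_right_real
    by (intro tendsto_lowerbound)
qed

section \<open>The dual norm\<close>

text \<open>
  A norm on \<open>\<real>\<^sup>n\<close> is convex, hence continuous, so it has a positive minimum on the Euclidean unit
  sphere. This makes the supremum that defines the dual norm a supremum of a bounded set.
\<close>

lemma is_norm_ge_euclidean:
  fixes N :: "real ^ 'n \<Rightarrow> real"
  assumes N: "is_norm N"
  obtains c where "c > 0" "\<And>x. c * norm x \<le> N x"
proof -
  have scale: "\<And>c x. N (c *\<^sub>R x) = \<bar>c\<bar> * N x" and tri: "\<And>x y. N (x + y) \<le> N x + N y"
    and nonneg: "\<And>x. 0 \<le> N x" and zero: "\<And>x. N x = 0 \<longleftrightarrow> x = 0"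
    using N by (auto simp: is_norm_def)
  have "convex_on UNIV N"
  proof (rule convex_onI)
    fix t :: real and x y :: "real ^ 'n" assume "0 < t" "t < 1"
    then show "N ((1 - t) *\<^sub>R x + t *\<^sub>R y) \<le> (1 - t) * N x + t * N y"
      using tri[of "(1 - t) *\<^sub>R x" "t *\<^sub>R y"] by (simp add: scale)
  qed simp
  then have "continuous_on UNIV N"
    by (intro convex_on_continuous) auto
  then have cont: "continuous_on (sphere 0 1) N"
    by (rule continuous_on_subset) simp
  have "sphere (0 :: real ^ 'n) 1 \<noteq> {}"
    by simp
  then obtain z where z: "z \<in> sphere 0 1" and least: "\<And>x. x \<in> sphere 0 1 \<Longrightarrow> N z \<le> N x"
    using continuous_attains_inf[OF compact_sphere _ cont] by blast
  have "N z > 0"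
    using z zero[of z] nonneg[of z] by auto
  moreover have "N z * norm x \<le> N x" for x
  proof (cases "x = 0")
    case True
    then show ?thesis using nonneg by simp
  next
    case False
    then have "N z \<le> N ((1 / norm x) *\<^sub>R x)"
      by (intro least) simp
    then show ?thesis using False by (simp add: scale field_simps)
  qed
  ultimately show ?thesis by (rule that)
qed

lemma inner_le_dual_norm:
  fixes N :: "real ^ 'n \<Rightarrow> real"
  assumes N: "is_norm N"
  shows "g \<bullet> h \<le> dual_norm N g * N h"
proof (cases "h = 0")
  case True
  then have "N h = 0" using N unfolding is_norm_def by blast
  then show ?thesis using True by simp
next
  case False
  then have pos: "N h > 0"
    using N by (metis is_norm_def less_eq_real_def)
  obtain c where c: "c > 0" "\<And>x. c * norm x \<le> N x"
    using is_norm_ge_euclidean[OF N] by blast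
  have "g \<bullet> x \<le> norm g * (1 / c)" if "N x \<le> 1" for x
  proof -
    have "norm x \<le> 1 / c"
      using c(2)[of x] that c(1) by (simp add: field_simps)
    then show ?thesis
      using norm_cauchy_schwarz[of g x] by (meson mult_left_mono norm_ge_zero order_trans)
  qed
  then have bdd: "bdd_above ((\<lambda>x. g \<bullet> x) ` {x. N x \<le> 1})"
    by (intro bdd_aboveI2) auto
  have "N ((1 / N h) *\<^sub>R h) = 1"
    using N pos False by (simp add: is_norm_def)
  then have "g \<bullet> ((1 / N h) *\<^sub>R h) \<le> dual_norm N g"
    unfolding dual_norm_def by (intro cSUP_upper bdd) simp
  then show ?thesis using pos by (simp add: field_simps)
qed

section \<open>Mirror steps\<close>

lemma bregman_three_points:
  "(g\<Phi> w - g\<Phi> z) \<bullet> (z - u) = bregman \<Phi> g\<Phi> u w - bregman \<Phi> g\<Phi> u z - bregman \<Phi> g\<Phi> z w"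
  by (simp add: bregman_def inner_simps)

lemma strongly_convex_on_bregman_ge:
  assumes "strongly_convex_on N S \<rho> \<Phi> g\<Phi>" "z \<in> S" "w \<in> S"
  shows "\<rho> / 2 * (N (w - z))\<^sup>2 \<le> bregman \<Phi> g\<Phi> z w"
proof -
  have "\<Phi> w - \<Phi> z \<le> g\<Phi> w \<bullet> (w - z) - \<rho> / 2 * (N (w - z))\<^sup>2"
    using assms by (auto simp: strongly_convex_on_def)
  then show ?thesis by (simp add: bregman_def inner_simps)
qed

text \<open>
  The derivative of \<open>v \<mapsto> D\<^sub>\<Phi>(v, w')\<close> at its minimizer \<open>z\<close> is \<open>\<nabla>\<Phi> z - \<nabla>\<Phi> w'\<close>, so by
  \<open>arg_min_first_order\<close> replacing \<open>\<nabla>\<Phi> w'\<close> by \<open>\<nabla>\<Phi> z\<close> does not decrease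
  \<open>\<eta>g \<bullet> (z - u) = (\<nabla>\<Phi> w - \<nabla>\<Phi> w') \<bullet> (z - u)\<close>; the rest is \<open>bregman_three_points\<close>.
\<close>

lemma mirror_step_inequality:
  fixes \<Phi> :: "real ^ 'n \<Rightarrow> real"
  assumes S: "convex S" and grad: "GDERIV \<Phi> z :> g\<Phi> z"
    and step: "g\<Phi> w' = g\<Phi> w - \<eta> *\<^sub>R g"
    and min: "is_arg_min (\<lambda>v. bregman \<Phi> g\<Phi> v w') (\<lambda>v. v \<in> S) z"
    and u: "u \<in> S"
  shows "\<eta> * (g \<bullet> (z - u)) \<le> bregman \<Phi> g\<Phi> u w - bregman \<Phi> g\<Phi> u z - bregman \<Phi> g\<Phi> z w"
proof -
  have [derivative_intros]: "(\<Phi> has_derivative (\<lambda>h. h \<bullet> g\<Phi> z)) (at z within S)"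
    using grad by (simp add: gderiv_def has_derivative_at_withinI)
  have "((\<lambda>v. bregman \<Phi> g\<Phi> v w') has_derivative (\<lambda>h. (g\<Phi> z - g\<Phi> w') \<bullet> h)) (at z within S)"
    unfolding bregman_def
    by (rule derivative_eq_intros refl)+ (simp add: fun_eq_iff inner_commute inner_diff_right)
  from arg_min_first_order[OF min this S u]
  have "(g\<Phi> w - g\<Phi> w') \<bullet> (z - u) \<le> (g\<Phi> w - g\<Phi> z) \<bullet> (z - u)"
    by (simp add: inner_simps)
  then show ?thesis
    using bregman_three_points[of g\<Phi> w z u \<Phi>] step by simp
qed

text \<open>
  The gain \<open>\<rho>/2 \<cdot> (a\<^sup>2 + b\<^sup>2)\<close> from strong convexity
  pays for the error \<open>\<eta>\<beta>ab = \<rho>ab\<close> made by using \<open>\<nabla>f x\<close> to compute the look-ahead point \<open>y\<close>;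
  this fixes the step size.
\<close>

lemma mirror_prox_step:
  fixes N :: "real ^ 'n \<Rightarrow> real"
  assumes N: "is_norm N"
    and S: "convex S" "S \<subseteq> X"
    and grad: "\<And>z. z \<in> S \<Longrightarrow> GDERIV \<Phi> z :> g\<Phi> z"
    and \<rho>: "\<rho> > 0" and sc: "strongly_convex_on N S \<rho> \<Phi> g\<Phi>"
    and f: "convex_on X f" and \<beta>: "\<beta> > 0" and sm: "smooth_on N X \<beta> f gf"
    and \<eta>: "\<eta> = \<rho> / \<beta>"
    and x: "x \<in> S" and u: "u \<in> S"
    and y': "g\<Phi> y' = g\<Phi> x - \<eta> *\<^sub>R gf x"
    and y: "is_arg_min (\<lambda>z. bregman \<Phi> g\<Phi> z y') (\<lambda>z. z \<in> S) y"
    and z': "g\<Phi> z' = g\<Phi> x - \<eta> *\<^sub>R gf y"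
    and z: "is_arg_min (\<lambda>z. bregman \<Phi> g\<Phi> z z') (\<lambda>z. z \<in> S) z"
  shows "\<eta> * (f y - f u) \<le> bregman \<Phi> g\<Phi> u x - bregman \<Phi> g\<Phi> u z"
proof -
  have yS: "y \<in> S" and zS: "z \<in> S"
    using y z by (auto simp: is_arg_min_def)
  have \<eta>0: "\<eta> > 0" using \<eta> \<rho> \<beta> by simp
  define a where "a = N (x - y)"
  define b where "b = N (y - z)"
  have "f y + gf y \<bullet> (u - y) \<le> f u"
    using sm S yS u by (intro convex_on_gradient_inequality[OF f]) (auto simp: smooth_on_def)
  then have "f y - f u \<le> gf y \<bullet> (z - u) + gf x \<bullet> (y - z) + (gf y - gf x) \<bullet> (y - z)"
    by (simp add: inner_simps)
  then have "\<eta> * (f y - f u)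
      \<le> \<eta> * (gf y \<bullet> (z - u)) + \<eta> * (gf x \<bullet> (y - z)) + \<eta> * ((gf y - gf x) \<bullet> (y - z))"
    using \<eta>0 by (simp flip: distrib_left)
  moreover have "\<eta> * (gf y \<bullet> (z - u))
      \<le> bregman \<Phi> g\<Phi> u x - bregman \<Phi> g\<Phi> u z - bregman \<Phi> g\<Phi> z x"
    by (rule mirror_step_inequality[where g\<Phi> = g\<Phi>, OF S(1) grad[OF zS] z' z u])
  moreover have "\<eta> * (gf x \<bullet> (y - z))
      \<le> bregman \<Phi> g\<Phi> z x - bregman \<Phi> g\<Phi> z y - bregman \<Phi> g\<Phi> y x"
    by (rule mirror_step_inequality[where g\<Phi> = g\<Phi>, OF S(1) grad[OF yS] y' y zS])
  moreover have "\<rho> / 2 * b\<^sup>2 \<le> bregman \<Phi> g\<Phi> z y" "\<rho> / 2 * a\<^sup>2 \<le> bregman \<Phi> g\<Phi> y x"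
    unfolding a_def b_def using strongly_convex_on_bregman_ge[OF sc] x yS zS by auto
  moreover have "\<eta> * ((gf y - gf x) \<bullet> (y - z)) \<le> \<rho> / 2 * a\<^sup>2 + \<rho> / 2 * b\<^sup>2"
  proof -
    have sym: "N (y - x) = a"
    proof -
      have "N ((-1) *\<^sub>R (x - y)) = \<bar>-1\<bar> * N (x - y)"
        using N unfolding is_norm_def by blast
      then show ?thesis by (simp add: a_def)
    qed
    have "(gf y - gf x) \<bullet> (y - z) \<le> dual_norm N (gf y - gf x) * b"
      unfolding b_def by (rule inner_le_dual_norm[OF N])
    also have "\<dots> \<le> \<beta> * a * b"
    proof (rule mult_right_mono)
      show "dual_norm N (gf y - gf x) \<le> \<beta> * a"
        using sm yS x S(2) sym by (auto simp: smooth_on_def)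
      show "0 \<le> b" using N by (simp add: b_def is_norm_def)
    qed
    finally have "\<eta> * ((gf y - gf x) \<bullet> (y - z)) \<le> \<eta> * (\<beta> * a * b)"
      using \<eta>0 by simp
    also have "\<dots> = \<rho> / 2 * (2 * a * b)"
      using \<eta> \<beta> by simp
    also have "\<dots> \<le> \<rho> / 2 * (a\<^sup>2 + b\<^sup>2)"
      using \<rho> sum_squares_bound[of a b] by (intro mult_left_mono) auto
    finally show ?thesis by (simp add: distrib_left)
  qed
  ultimately show ?thesis by linarith
qed

section \<open>Regret and the averaged iterate\<close>

lemma telescoping_average_bound:
  fixes f :: "'a::real_vector \<Rightarrow> real" and d :: "nat \<Rightarrow> real"
  assumes f: "convex_on X f" and t: "t \<ge> 1" and \<eta>: "\<eta> > 0"
    and y: "\<And>s. s \<ge> 1 \<Longrightarrow> y (Suc s) \<in> X"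
    and step: "\<And>s. s \<ge> 1 \<Longrightarrow> \<eta> * (f (y (Suc s)) - c) \<le> d s - d (Suc s)"
    and d: "d (Suc t) \<ge> 0"
  shows "f ((1 / real t) *\<^sub>R (\<Sum>s=1..t. y (Suc s))) - c \<le> d 1 / (\<eta> * real t)"
proof -
  have "f (\<Sum>s=1..t. (1 / real t) *\<^sub>R y (Suc s)) \<le> (\<Sum>s=1..t. (1 / real t) * f (y (Suc s)))"
    using t y convex_on_imp_convex[OF f] by (intro convex_on_sum[OF _ _ f]) auto
  then have "f ((1 / real t) *\<^sub>R (\<Sum>s=1..t. y (Suc s))) \<le> (\<Sum>s=1..t. f (y (Suc s))) / real t"
    by (simp add: scaleR_right.sum sum_divide_distrib)
  moreover have "\<eta> * ((\<Sum>s=1..t. f (y (Suc s))) - real t * c) \<le> d 1"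
  proof -
    have "\<eta> * ((\<Sum>s=1..t. f (y (Suc s))) - real t * c) = (\<Sum>s=1..t. \<eta> * (f (y (Suc s)) - c))"
      by (simp add: sum_distrib_left sum_subtractf right_diff_distrib)
    also have "\<dots> \<le> (\<Sum>s=1..t. d s - d (Suc s))"
      by (intro sum_mono step) simp
    also have "\<dots> = d 1 - d (Suc t)"
      using sum_Suc_diff'[of 1 "Suc t" "\<lambda>s. - d s"] t
      by (simp add: atLeastLessThanSuc_atLeastAtMost)
    finally show ?thesis using d by linarith
  qed
  then have "\<eta> * ((\<Sum>s=1..t. f (y (Suc s))) - real t * c) / (\<eta> * real t) \<le> d 1 / (\<eta> * real t)"
    using \<eta> by (intro divide_right_mono) auto
  then have "(\<Sum>s=1..t. f (y (Suc s))) / real t - c \<le> d 1 / (\<eta> * real t)"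
    using t \<eta> by (simp add: diff_divide_distrib)
  ultimately show ?thesis by linarith
qed

text \<open>
  The half-open segment from a point \<open>p\<close> of the open set to a point \<open>q\<close> of its closure stays in the
  open set, and along it \<open>f\<close> lies below its chord, which tends to \<open>f q\<close>.
\<close>

lemma convex_bound_extends_to_closure:
  fixes f :: "'a::euclidean_space \<Rightarrow> real"
  assumes D: "open D" "convex D" "X \<subseteq> closure D"
    and f: "convex_on X f" and p: "p \<in> X \<inter> D" and q: "q \<in> X"
    and bound: "\<And>u. u \<in> X \<inter> D \<Longrightarrow> C \<le> f u"
  shows "C \<le> f q"
proof -
  have "C \<le> (1 - e) * f q + e * f p" if e: "0 < e" "e < 1" for e
  proof -
    have eq: "(1 - e) *\<^sub>R q + e *\<^sub>R p = q - e *\<^sub>R (q - p)"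
      by (simp add: algebra_simps)
    have "q - e *\<^sub>R (q - p) \<in> interior D"
      using D p q e by (intro mem_interior_closure_convex_shrink) (auto simp: interior_open)
    then have "(1 - e) *\<^sub>R q + e *\<^sub>R p \<in> D"
      using D(1) eq by (simp add: interior_open)
    moreover have "(1 - e) *\<^sub>R q + e *\<^sub>R p \<in> X"
      using convex_on_imp_convex[OF f] p q e by (intro convexD) auto
    ultimately have "C \<le> f ((1 - e) *\<^sub>R q + e *\<^sub>R p)"
      by (intro bound) simp
    also have "\<dots> \<le> (1 - e) * f q + e * f p"
      using convex_onD[OF f, of e q p] p q e by simp
    finally show ?thesis .
  qed
  then have "\<forall>\<^sub>F e in at_right (0::real). C \<le> (1 - e) * f q + e * f p"
    unfolding eventually_at_right_field by (intro exI[of _ 1]) auto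
  moreover have "((\<lambda>e. (1 - e) * f q + e * f p) \<longlongrightarrow> (1 - 0) * f q + 0 * f p) (at_right 0)"
    by (intro tendsto_intros)
  ultimately have "C \<le> (1 - 0) * f q + 0 * f p"
    using trivial_limit_at_right_real by (intro tendsto_lowerbound)
  then show ?thesis by simp
qed

theorem theorem4p4:
  fixes N :: "real ^ 'n \<Rightarrow> real"
    and X D :: "(real ^ 'n) set"
    and \<Phi> f :: "real ^ 'n \<Rightarrow> real"
    and g\<Phi> gf :: "real ^ 'n \<Rightarrow> real ^ 'n"
    and \<rho> \<beta> \<eta> :: real
    and R :: ereal
    and x y x' y' :: "nat \<Rightarrow> real ^ 'n"
    and xstar :: "real ^ 'n"
    and t :: nat
  assumes "is_norm N"
    and "compact X" and "convex X"
    and "mirror_map N X D \<Phi> g\<Phi>"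
    and "\<rho> > 0" and "strongly_convex_on N (X \<inter> D) \<rho> \<Phi> g\<Phi>"
    and "is_arg_min \<Phi> (\<lambda>z. z \<in> X \<inter> D) (x 1)"
    and "R\<^sup>2 = (SUP z\<in>X \<inter> D. ereal (\<Phi> z)) - ereal (\<Phi> (x 1))"
    and "convex_on X f"
    and "\<beta> > 0" and "smooth_on N X \<beta> f gf"
    and "is_arg_min f (\<lambda>z. z \<in> X) xstar"
    and "\<eta> = \<rho> / \<beta>"
    and "\<And>s. s \<ge> 1 \<Longrightarrow> y' (Suc s) \<in> D \<and> g\<Phi> (y' (Suc s)) = g\<Phi> (x s) - \<eta> *\<^sub>R gf (x s)"
    and "\<And>s. s \<ge> 1 \<Longrightarrow> is_arg_min (\<lambda>z. bregman \<Phi> g\<Phi> z (y' (Suc s))) (\<lambda>z. z \<in> X \<inter> D) (y (Suc s))"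
    and "\<And>s. s \<ge> 1 \<Longrightarrow> x' (Suc s) \<in> D \<and> g\<Phi> (x' (Suc s)) = g\<Phi> (x s) - \<eta> *\<^sub>R gf (y (Suc s))"
    and "\<And>s. s \<ge> 1 \<Longrightarrow> is_arg_min (\<lambda>z. bregman \<Phi> g\<Phi> z (x' (Suc s))) (\<lambda>z. z \<in> X \<inter> D) (x (Suc s))"
    and "t \<ge> 1"
  shows "ereal (f ((1 / real t) *\<^sub>R (\<Sum>s=1..t. y (Suc s))) - f xstar)
           \<le> ereal \<beta> * R\<^sup>2 / ereal (\<rho> * real t)"
proof -
  let ?S = "X \<inter> D"
  let ?avg = "(1 / real t) *\<^sub>R (\<Sum>s=1..t. y (Suc s))"
  note N = assms(1) and \<rho> = assms(5) and sc = assms(6) and x1 = assms(7) and R = assms(8)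
    and f = assms(9) and \<beta> = assms(10) and sm = assms(11) and xstar = assms(12)
    and \<eta> = assms(13) and y' = assms(14) and y = assms(15) and x' = assms(16) and x = assms(17)
    and t = assms(18)
  have D: "open D" "convex D" "X \<subseteq> closure D"
    and grad: "\<And>z. z \<in> ?S \<Longrightarrow> GDERIV \<Phi> z :> g\<Phi> z"
    using assms(4) by (auto simp: mirror_map_def)
  have S: "convex ?S" "?S \<subseteq> X"
    using assms(3) D(2) by (auto intro: convex_Int)
  have x1S: "x 1 \<in> ?S" using x1 by (simp add: is_arg_min_def)
  have yS: "y (Suc s) \<in> ?S" and xS: "x (Suc s) \<in> ?S" if "s \<ge> 1" for s
    using x[OF that] y[OF that] by (auto simp: is_arg_min_def)
  have xS': "x s \<in> ?S" if "s \<ge> 1" for s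
    using that x1S xS[of "s - 1"] by (cases "s = 1") auto
  have \<eta>0: "\<eta> > 0" using \<eta> \<rho> \<beta> by simp

  have regret: "f ?avg - f u \<le> \<beta> * (\<Phi> u - \<Phi> (x 1)) / (\<rho> * real t)" if u: "u \<in> ?S" for u
  proof -
    let ?d = "\<lambda>s. bregman \<Phi> g\<Phi> u (x s)"
    have "f ?avg - f u \<le> ?d 1 / (\<eta> * real t)"
    proof (rule telescoping_average_bound[OF f t \<eta>0])
      show "y (Suc s) \<in> X" if "s \<ge> 1" for s
        using yS[OF that] by simp
      show "\<eta> * (f (y (Suc s)) - f u) \<le> ?d s - ?d (Suc s)" if "s \<ge> 1" for s
        using y'[OF that] x'[OF that]
        by (intro mirror_prox_step[OF N S grad \<rho> sc f \<beta> sm \<eta> xS'[OF that] u _ y[OF that] _ x[OF that]])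
          auto
      have "0 \<le> \<rho> / 2 * (N (x (Suc t) - u))\<^sup>2"
        using \<rho> by simp
      also have "\<dots> \<le> ?d (Suc t)"
        by (rule strongly_convex_on_bregman_ge[OF sc u xS[OF t]])
      finally show "0 \<le> ?d (Suc t)" .
    qed
    also have "\<dots> \<le> (\<Phi> u - \<Phi> (x 1)) / (\<eta> * real t)"
    proof (rule divide_right_mono)
      have "(\<Phi> has_derivative (\<lambda>h. h \<bullet> g\<Phi> (x 1))) (at (x 1) within ?S)"
        using grad[OF x1S] by (simp add: gderiv_def has_derivative_at_withinI)
      from arg_min_first_order[OF x1 this S(1) u]
      show "?d 1 \<le> \<Phi> u - \<Phi> (x 1)"
        by (simp add: bregman_def inner_commute)
      show "0 \<le> \<eta> * real t" using \<eta>0 by simp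
    qed
    finally show ?thesis using \<eta> by (simp add: mult.commute)
  qed

  have pos: "\<rho> * real t > 0" using \<rho> t by simp
  show ?thesis
  proof (cases "SUP z\<in>?S. ereal (\<Phi> z)")
    case (real M)
    have le_M: "\<Phi> u \<le> M" if "u \<in> ?S" for u
      using SUP_upper[OF that, of "\<lambda>z. ereal (\<Phi> z)"] real by simp
    have "f ?avg - \<beta> * (M - \<Phi> (x 1)) / (\<rho> * real t) \<le> f xstar"
    proof (rule convex_bound_extends_to_closure[OF D f x1S])
      show "xstar \<in> X" using xstar by (simp add: is_arg_min_def)
      fix u assume u: "u \<in> ?S"
      have "\<beta> * (\<Phi> u - \<Phi> (x 1)) / (\<rho> * real t) \<le> \<beta> * (M - \<Phi> (x 1)) / (\<rho> * real t)"
        using le_M[OF u] \<beta> pos by (intro divide_right_mono mult_left_mono) auto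
      then show "f ?avg - \<beta> * (M - \<Phi> (x 1)) / (\<rho> * real t) \<le> f u"
        using regret[OF u] by linarith
    qed
    moreover have "ereal \<beta> * R\<^sup>2 / ereal (\<rho> * real t) = ereal (\<beta> * (M - \<Phi> (x 1)) / (\<rho> * real t))"
      using R real \<rho> t by simp
    ultimately show ?thesis by simp
  next
    \<comment> \<open>If \<open>\<Phi>\<close> is unbounded above on \<open>X \<inter> D\<close> the right-hand side is infinite.\<close>
    case PInf
    then have "ereal \<beta> * R\<^sup>2 / ereal (\<rho> * real t) = \<infinity>"
      using R \<beta> pos by simp
    then show ?thesis by simp
  next
    case MInf
    then show ?thesis
      using SUP_upper[OF x1S, of "\<lambda>z. ereal (\<Phi> z)"] by simp
  qed
qed

end
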